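(* Let $\Gamma$ be a group. (i) Each $A\in\mathcal A_\Gamma$ is isomorphic to $(\mathbf F_p)^n$ for some prime $p$ and some positive integer $n$ (depending on $A$). (ii) There exists a subset $\{A_i\}_{i\in I}$ of $\mathcal A_\Gamma$ such that $MA(\Gamma)=\bigoplus_{i\in I}A_i$. In particular, the group $MA(\Gamma)$ is abelian. (iii) For each $H\in\mathcal H_\Gamma$, the feet $S_1,\dots,S_k$ of $H$ are conjugate in $\Gamma$, and simple. Moreover $H=S_1\oplus\cdots\oplus S_k$. (iv) $MH(\Gamma)=\bigoplus_{H\in\mathcal H_\Gamma}H$. (v) $MS(\Gamma)=MA(\Gamma)\oplus MH(\Gamma)$.
   Context: A foot of a group $\Gamma$ is a minimal normal subgroup of $\Gamma$: a normal subgroup $M\ne\{e\}$ such that every normal subgroup of $\Gamma$ contained in $M$ is $M$ or $\{e\}$. $\mathcal F_\Gamma$ is the set of finite feet of $\Gamma$, $\mathcal A_\Gamma\subset\mathcal F_\Gamma$ the subset of abelian ones, and $\mathcal H_\Gamma=\mathcal F_\Gamma\setminus\mathcal A_\Gamma$. $MS(\Gamma)$ (the minisocle), $MA(\Gamma)$, $MH(\Gamma)$ are the subgroups of $\Gamma$ generated respectively by $\bigcup_{M\in\mathcal F_\Gamma}M$, $\bigcup_{A\in\mathcal A_\Gamma}A$, $\bigcup_{H\in\mathcal H_\Gamma}H$ (equal to $\{e\}$ if the corresponding set of feet is empty). Direct sums are internal (restricted) direct sums of subgroups. $\mathbf F_p$ denotes the additive group of the field with $p$ elements. *)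

theory Defs
  imports "HOL-Algebra.Algebra" "HOL-Number_Theory.Residues"
begin

definition feet :: "('a, 'b) monoid_scheme \<Rightarrow> 'a set set" where
  "feet G = {M. M \<lhd> G \<and> M \<noteq> {\<one>\<^bsub>G\<^esub>} \<and>
     (\<forall>N. N \<lhd> G \<longrightarrow> N \<subseteq> M \<longrightarrow> N = M \<or> N = {\<one>\<^bsub>G\<^esub>})}"

definition finite_feet :: "('a, 'b) monoid_scheme \<Rightarrow> 'a set set" where
  "finite_feet G = {M \<in> feet G. finite M}"

definition abelian_feet :: "('a, 'b) monoid_scheme \<Rightarrow> 'a set set" where
  "abelian_feet G = {M \<in> finite_feet G. comm_group (G\<lparr>carrier := M\<rparr>)}"

definition nonabelian_feet :: "('a, 'b) monoid_scheme \<Rightarrow> 'a set set" where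
  "nonabelian_feet G = finite_feet G - abelian_feet G"

(* generate G {} is the trivial subgroup, as wanted when there are no feet of the given kind *)

definition MS :: "('a, 'b) monoid_scheme \<Rightarrow> 'a set" where
  "MS G = generate G (\<Union>(finite_feet G))"

definition MA :: "('a, 'b) monoid_scheme \<Rightarrow> 'a set" where
  "MA G = generate G (\<Union>(abelian_feet G))"

definition MH :: "('a, 'b) monoid_scheme \<Rightarrow> 'a set" where
  "MH G = generate G (\<Union>(nonabelian_feet G))"

(* The subgroup K of G is the internal restricted direct sum of the subgroups H i, i \<in> I:
   each H i is normal in K, they generate K, and each meets the subgroup generated by the
   others trivially.  Members of the family with different indices therefore commute
   elementwise.  The family may be infinite or empty, and K need not be abelian. *)
definition internal_direct_sum ::
    "('a, 'b) monoid_scheme \<Rightarrow> 'i set \<Rightarrow> ('i \<Rightarrow> 'a set) \<Rightarrow> 'a set \<Rightarrow> bool" where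
  "internal_direct_sum G I H K \<longleftrightarrow>
     K = generate G (\<Union>i\<in>I. H i) \<and>
     (\<forall>i\<in>I. H i \<lhd> G\<lparr>carrier := K\<rparr>) \<and>
     (\<forall>i\<in>I. H i \<inter> generate G (\<Union>j\<in>I - {i}. H j) = {\<one>\<^bsub>G\<^esub>})"

definition conjugate_in :: "('a, 'b) monoid_scheme \<Rightarrow> 'a set \<Rightarrow> 'a set \<Rightarrow> bool" where
  "conjugate_in G S T \<longleftrightarrow> (\<exists>g\<in>carrier G. T = (\<lambda>s. g \<otimes>\<^bsub>G\<^esub> s \<otimes>\<^bsub>G\<^esub> inv\<^bsub>G\<^esub> g) ` S)"

(* Additive group of the ring of integers modulo p; used only for p prime. *)
definition additive_F :: "nat \<Rightarrow> int monoid" where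
  "additive_F p = add_monoid (residue_ring (int p))"

end

theory Submission
  imports Defs
begin

text \<open>
  Distinct feet meet trivially and hence commute elementwise. A nonabelian foot therefore meets the
  span of any other feet trivially: otherwise, by minimality, it would be contained in that span,
  commute with it and be abelian. The same commutation shows that an element of \<open>MA \<inter> MH\<close> is central
  in a finite product of nonabelian feet, whose centre is trivial. An abelian foot is
  characteristically simple, so it has prime exponent; a maximal independent set of abelian
  feet spans \<open>MA\<close>. Inside a finite nonabelian foot \<open>H\<close>, the conjugates of any foot \<open>S\<close> of \<open>H\<close> generate a
  normal subgroup of the whole group, hence \<open>H\<close> itself; so \<open>S\<close> is nonabelian, and a foot of \<open>H\<close>
  not conjugate to \<open>S\<close> would meet \<open>H\<close> trivially.
\<close>

section \<open>Centralizers and subgroups generated by normal subgroups\<close>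

lemma (in group) comm_group_subgroup_iff:
  assumes "subgroup H G"
  shows "comm_group (G\<lparr>carrier := H\<rparr>) \<longleftrightarrow> (\<forall>x\<in>H. \<forall>y\<in>H. x \<otimes> y = y \<otimes> x)"
proof
  assume "comm_group (G\<lparr>carrier := H\<rparr>)"
  then interpret C: comm_group "G\<lparr>carrier := H\<rparr>" .
  show "\<forall>x\<in>H. \<forall>y\<in>H. x \<otimes> y = y \<otimes> x"
    using C.m_comm by simp
next
  assume "\<forall>x\<in>H. \<forall>y\<in>H. x \<otimes> y = y \<otimes> x"
  then show "comm_group (G\<lparr>carrier := H\<rparr>)"
    by (intro group.group_comm_groupI subgroup_imp_group assms) auto
qed

lemma (in group) subgroup_elementwise_centralizer:
  assumes "z \<in> carrier G"
  shows "subgroup {x \<in> carrier G. x \<otimes> z = z \<otimes> x} G"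
proof (rule subgroupI)
  fix x assume "x \<in> {x \<in> carrier G. x \<otimes> z = z \<otimes> x}"
  then have x: "x \<in> carrier G" "x \<otimes> z = z \<otimes> x" by auto
  then have "inv x \<otimes> z = z \<otimes> inv x"
    using assms by (metis inv_closed inv_solve_left inv_solve_right m_assoc m_closed)
  with x show "inv x \<in> {x \<in> carrier G. x \<otimes> z = z \<otimes> x}" by simp
next
  fix x y
  assume "x \<in> {x \<in> carrier G. x \<otimes> z = z \<otimes> x}" "y \<in> {x \<in> carrier G. x \<otimes> z = z \<otimes> x}"
  then show "x \<otimes> y \<in> {x \<in> carrier G. x \<otimes> z = z \<otimes> x}"
    using assms by auto (metis m_assoc)
qed (use assms in auto)

text \<open>The centralizer of \<open>z\<close> is a subgroup, so it is enough that it contains the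
  generators. This is how commutation passes from feet to their spans.\<close>

lemma (in group) generate_commutes:
  assumes "U \<subseteq> carrier G" "z \<in> carrier G" "\<And>x. x \<in> U \<Longrightarrow> x \<otimes> z = z \<otimes> x"
    and "y \<in> generate G U"
  shows "y \<otimes> z = z \<otimes> y"
proof -
  have "U \<subseteq> {x \<in> carrier G. x \<otimes> z = z \<otimes> x}"
    using assms(1,3) by auto
  from generate_subgroup_incl[OF this subgroup_elementwise_centralizer[OF assms(2)]]
  show ?thesis using assms(4) by auto
qed

lemma (in group) normal_generate_Union:
  assumes "\<And>N. N \<in> \<S> \<Longrightarrow> N \<lhd> G"
  shows "generate G (\<Union>\<S>) \<lhd> G"
proof (rule normal_generateI)
  show "\<Union>\<S> \<subseteq> carrier G"
    using subgroup.subset[OF normal_imp_subgroup[OF assms]] by auto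
  fix h g assume g: "g \<in> carrier G" and "h \<in> \<Union>\<S>"
  then obtain N where "N \<in> \<S>" "h \<in> N" by blast
  with g show "g \<otimes> h \<otimes> inv g \<in> \<Union>\<S>"
    using normal.inv_op_closed2[OF assms, of N g h] by auto
qed

text \<open>The product of two normal subgroups is already a subgroup, so it contains whatever the
  two generate. Its use is to split an element of a span into one factor from each side.\<close>

lemma (in group) generate_Un_normal_subset:
  assumes "M \<lhd> G" "N \<lhd> G"
  shows "generate G (M \<union> N) \<subseteq> M <#> N"
proof (rule generate_subgroup_incl)
  interpret M: normal M G by fact
  interpret N: normal N G by fact
  show "subgroup (M <#> N) G"
    by (rule mult_norm_subgroup) (auto intro: assms normal_imp_subgroup)
  have "x \<otimes> \<one> \<in> M <#> N" if "x \<in> M" for x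
    using that N.one_closed unfolding set_mult_def by blast
  moreover have "\<one> \<otimes> x \<in> M <#> N" if "x \<in> N" for x
    using that M.one_closed unfolding set_mult_def by blast
  ultimately show "M \<union> N \<subseteq> M <#> N" by auto
qed

text \<open>Each step in the generation of \<open>x\<close> involves only finitely many members of
  the family. This brings chains in Zorn's lemma and infinite sets of feet down to finite
  subfamilies.\<close>

lemma (in group) generate_Union_finite_support:
  assumes "x \<in> generate G (\<Union>\<S>)"
  shows "\<exists>\<F>\<subseteq>\<S>. finite \<F> \<and> x \<in> generate G (\<Union>\<F>)"
  using assms
proof (induction rule: generate.induct)
  case one
  then show ?case by (intro exI[of _ "{}"]) (auto intro: generate.one)
next
  case (incl h)
  then obtain N where "N \<in> \<S>" "h \<in> N" by blast
  then show ?case by (intro exI[of _ "{N}"]) (auto intro: generate.incl)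
next
  case (inv h)
  then obtain N where "N \<in> \<S>" "h \<in> N" by blast
  then show ?case by (intro exI[of _ "{N}"]) (auto intro: generate.inv)
next
  case (eng h1 h2)
  then obtain F1 F2 where F: "F1 \<subseteq> \<S>" "finite F1" "h1 \<in> generate G (\<Union>F1)"
    "F2 \<subseteq> \<S>" "finite F2" "h2 \<in> generate G (\<Union>F2)" by blast
  have "h1 \<in> generate G (\<Union>(F1 \<union> F2))" "h2 \<in> generate G (\<Union>(F1 \<union> F2))"
    using mono_generate[of "\<Union>F1" "\<Union>(F1 \<union> F2)"] mono_generate[of "\<Union>F2" "\<Union>(F1 \<union> F2)"] F by auto
  then show ?case
    using F by (intro exI[of _ "F1 \<union> F2"]) (auto intro: generate.eng)
qed

section \<open>Independent families of normal subgroups\<close>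

text \<open>The trivial-intersection clause of \<open>internal_direct_sum\<close> for a set of
  subgroups indexed by itself. For normal subgroups of the whole group and their span the remaining
  clauses are automatic, so this is the only condition to track.\<close>

definition independent_family :: "('a, 'b) monoid_scheme \<Rightarrow> 'a set set \<Rightarrow> bool" where
  "independent_family G \<S> \<longleftrightarrow> (\<forall>N\<in>\<S>. N \<inter> generate G (\<Union>(\<S> - {N})) = {\<one>\<^bsub>G\<^esub>})"

lemma (in group) internal_direct_sum_normal:
  assumes "\<And>N. N \<in> \<S> \<Longrightarrow> N \<lhd> G" "independent_family G \<S>"
  shows "internal_direct_sum G \<S> (\<lambda>N. N) (generate G (\<Union>\<S>))"
proof -
  have sub: "subgroup (generate G (\<Union>\<S>)) G"
    using normal_imp_subgroup[OF normal_generate_Union[OF assms(1)]] by simp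
  have "N \<lhd> G\<lparr>carrier := generate G (\<Union>\<S>)\<rparr>" if "N \<in> \<S>" for N
    using that assms(1) by (intro normal_restrict_supergroup sub) (auto intro: generate.incl)
  then show ?thesis
    using assms(2) unfolding internal_direct_sum_def independent_family_def by simp
qed

text \<open>Suppose an element of an old member \<open>L\<close> equals k m, with k in the span of
  the other old members and m in \<open>M\<close>. Then m lies in the span of the old family, hence
  is trivial, and independence of the old family forces k to be trivial too.\<close>

lemma (in group) independent_family_insert:
  assumes N: "\<And>N. N \<in> \<S> \<Longrightarrow> N \<lhd> G" and ind: "independent_family G \<S>"
    and M: "M \<lhd> G" and disj: "M \<inter> generate G (\<Union>\<S>) = {\<one>}"
  shows "independent_family G (insert M \<S>)"
proof (cases "M \<in> \<S>")
  case True
  then show ?thesis using ind by (simp add: insert_absorb)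
next
  case False
  have "L \<inter> generate G (\<Union>(insert M \<S> - {L})) = {\<one>}" if L: "L \<in> \<S>" for L
  proof -
    let ?K = "generate G (\<Union>(\<S> - {L}))"
    have K: "?K \<lhd> G" using N by (intro normal_generate_Union) auto
    interpret M: normal M G by fact
    interpret L: normal L G using L N by auto
    interpret K: normal ?K G by fact
    have sub: "subgroup (generate G (\<Union>\<S>)) G"
      using normal_generate_Union[OF N] normal_imp_subgroup by auto
    interpret S: subgroup "generate G (\<Union>\<S>)" G by (fact sub)
    have "x = \<one>" if x: "x \<in> L" "x \<in> generate G (\<Union>(insert M \<S> - {L}))" for x
    proof -
      have "\<Union>(insert M \<S> - {L}) \<subseteq> ?K \<union> M"
        by (auto intro: generate.incl)
      then have "x \<in> ?K <#> M"
        using x(2) mono_generate generate_Un_normal_subset[OF K M] by (meson subsetD)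
      then obtain k m where km: "k \<in> ?K" "m \<in> M" "x = k \<otimes> m"
        unfolding set_mult_def by auto
      have xS: "x \<in> generate G (\<Union>\<S>)" using x(1) L by (auto intro: generate.incl)
      have kS: "k \<in> generate G (\<Union>\<S>)"
        using km(1) mono_generate[of "\<Union>(\<S> - {L})" "\<Union>\<S>"] Union_mono[of "\<S> - {L}" \<S>] by auto
      have "m = inv k \<otimes> x"
        using km K.mem_carrier M.mem_carrier by (simp add: inv_solve_left)
      then have "m \<in> generate G (\<Union>\<S>)" using xS kS by simp
      then have "m = \<one>" using km disj by blast
      then have "x = k" using km K.mem_carrier by simp
      then show ?thesis
        using x km ind L unfolding independent_family_def by blast
    qed
    then show ?thesis using L.one_closed generate.one by blast
  qed
  moreover have "M \<inter> generate G (\<Union>(insert M \<S> - {M})) = {\<one>}"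
    using disj False by simp
  ultimately show ?thesis unfolding independent_family_def by auto
qed

text \<open>A failure of independence involves one member and finitely many others, and all of these
  already lie in a single family of the chain.\<close>

lemma (in group) independent_family_Union_chain:
  assumes C: "subset.chain {\<S>. independent_family G \<S>} \<C>"
  shows "independent_family G (\<Union>\<C>)"
  unfolding independent_family_def
proof
  fix N assume "N \<in> \<Union>\<C>"
  then obtain \<A> where \<A>: "\<A> \<in> \<C>" "N \<in> \<A>" by blast
  have ind: "independent_family G \<S>" if "\<S> \<in> \<C>" for \<S>
    using that C unfolding subset.chain_def by auto
  have one: "\<one> \<in> N" using ind[OF \<A>(1)] \<A>(2) unfolding independent_family_def by blast
  have "x = \<one>" if x: "x \<in> N" "x \<in> generate G (\<Union>(\<Union>\<C> - {N}))" for x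
  proof -
    obtain \<F> where \<F>: "\<F> \<subseteq> \<Union>\<C> - {N}" "finite \<F>" "x \<in> generate G (\<Union>\<F>)"
      using generate_Union_finite_support[OF x(2)] by blast
    have "finite (insert N \<F>)" "insert N \<F> \<subseteq> \<Union>\<C>" "\<C> \<noteq> {}" using \<F> \<A> by auto
    then obtain \<B> where \<B>: "\<B> \<in> \<C>" "insert N \<F> \<subseteq> \<B>"
      using finite_subset_Union_chain[OF _ _ _ C] by metis
    have "x \<in> generate G (\<Union>(\<B> - {N}))"
      using \<F> \<B> mono_generate[of "\<Union>\<F>" "\<Union>(\<B> - {N})"] Union_mono[of \<F> "\<B> - {N}"] by blast
    then show ?thesis
      using ind[OF \<B>(1)] \<B>(2) x(1) unfolding independent_family_def by blast
  qed
  then show "N \<inter> generate G (\<Union>(\<Union>\<C> - {N})) = {\<one>}"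
    using one generate.one by blast
qed

section \<open>Minimality and commutation of feet\<close>

lemma feet_normal: "M \<in> feet G \<Longrightarrow> M \<lhd> G"
  by (simp add: feet_def)

lemma feet_subgroup: "M \<in> feet G \<Longrightarrow> subgroup M G"
  by (rule normal_imp_subgroup[OF feet_normal])

lemma feet_subset: "M \<in> feet G \<Longrightarrow> M \<subseteq> carrier G"
  by (rule subgroup.subset[OF feet_subgroup])

lemma (in group) foot_Int_normal:
  assumes "M \<in> feet G" "N \<lhd> G"
  shows "M \<subseteq> N \<or> M \<inter> N = {\<one>}"
proof -
  have "M \<inter> N \<lhd> G" by (rule normal_subgroup_intersect[OF feet_normal[OF assms(1)] assms(2)])
  then have "M \<inter> N = M \<or> M \<inter> N = {\<one>}" using assms(1) unfolding feet_def by blast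
  then show ?thesis by blast
qed

lemma (in group) distinct_feet_Int:
  assumes "M \<in> feet G" "N \<in> feet G" "M \<noteq> N"
  shows "M \<inter> N = {\<one>}"
proof (rule ccontr)
  assume not: "M \<inter> N \<noteq> {\<one>}"
  then have "M \<subseteq> N" using foot_Int_normal[OF assms(1) feet_normal[OF assms(2)]] by simp
  then have "M = N \<or> M = {\<one>}" using assms(2) feet_normal[OF assms(1)] by (simp add: feet_def)
  then show False using assms(1,3) by (simp add: feet_def)
qed

text \<open>A commutator of elements of two normal subgroups lies in their intersection, which is
  trivial here.\<close>

lemma (in group) distinct_feet_commute:
  assumes "M \<in> feet G" "N \<in> feet G" "M \<noteq> N" "x \<in> M" "y \<in> N"
  shows "x \<otimes> y = y \<otimes> x"
  using normal_imp_commuting[OF feet_normal[OF assms(1)] feet_normal[OF assms(2)] _ assms(4,5)]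
    distinct_feet_Int[OF assms(1-3)] by simp

text \<open>Zorn's lemma gives a maximal independent subfamily \<open>\<B>\<close>. A foot outside
  its span would meet that span trivially by minimality and could be added, so the span already
  contains every foot of the family.\<close>

lemma (in group) feet_span_internal_direct_sum:
  assumes \<S>: "\<S> \<subseteq> feet G"
  shows "\<exists>\<B>\<subseteq>\<S>. internal_direct_sum G \<B> (\<lambda>M. M) (generate G (\<Union>\<S>))"
proof -
  let ?P = "{\<B>. \<B> \<subseteq> \<S> \<and> independent_family G \<B>}"
  have "\<exists>\<B>\<in>?P. \<forall>\<D>\<in>?P. \<B> \<subseteq> \<D> \<longrightarrow> \<D> = \<B>"
  proof (rule subset_Zorn')
    fix \<C> assume "subset.chain ?P \<C>"
    then have "\<C> \<subseteq> ?P" "subset.chain {\<S>. independent_family G \<S>} \<C>"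
      unfolding subset.chain_def by auto
    then show "\<Union>\<C> \<in> ?P" using independent_family_Union_chain by auto
  qed
  then obtain \<B> where \<B>: "\<B> \<subseteq> \<S>" "independent_family G \<B>"
    and max: "\<forall>\<D>\<in>?P. \<B> \<subseteq> \<D> \<longrightarrow> \<D> = \<B>" by auto
  have normal: "N \<lhd> G" if "N \<in> \<B>" for N
    using that \<B>(1) \<S> by (intro feet_normal) auto
  have gen: "generate G (\<Union>\<B>) \<lhd> G" using normal_generate_Union[OF normal] .
  have "M \<subseteq> generate G (\<Union>\<B>)" if M: "M \<in> \<S>" for M
  proof (rule ccontr)
    assume not: "\<not> M \<subseteq> generate G (\<Union>\<B>)"
    then have "M \<inter> generate G (\<Union>\<B>) = {\<one>}"
      using foot_Int_normal[OF _ gen, of M] M \<S> by auto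
    then have "independent_family G (insert M \<B>)"
      using independent_family_insert[OF normal \<B>(2), of M] feet_normal[of M G] M \<S> by auto
    then have "M \<in> \<B>" using max[rule_format, of "insert M \<B>"] M \<B> by auto
    then show False using not by (auto intro: generate.incl)
  qed
  then have "generate G (\<Union>\<S>) \<subseteq> generate G (\<Union>\<B>)"
    using generate_subgroup_incl[OF _ normal_imp_subgroup[OF gen]] by (simp add: Union_least)
  moreover have "generate G (\<Union>\<B>) \<subseteq> generate G (\<Union>\<S>)"
    using \<B>(1) by (intro mono_generate) auto
  ultimately have "generate G (\<Union>\<S>) = generate G (\<Union>\<B>)" by blast
  then show ?thesis
    using \<B> internal_direct_sum_normal[OF normal \<B>(2)] by (intro exI[of _ \<B>]) simp
qed

lemma (in group) feet_subset_carrier: "\<S> \<subseteq> feet G \<Longrightarrow> \<Union>\<S> \<subseteq> carrier G"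
  using feet_subset[of _ G] by auto

lemma (in group) comm_group_MA: "comm_group (G\<lparr>carrier := MA G\<rparr>)"
proof -
  have sub: "abelian_feet G \<subseteq> feet G" by (auto simp: abelian_feet_def finite_feet_def)
  let ?U = "\<Union>(abelian_feet G)"
  have U: "?U \<subseteq> carrier G" using feet_subset_carrier[OF sub] .
  have comm: "x \<otimes> y = y \<otimes> x" if xy: "x \<in> ?U" "y \<in> ?U" for x y
  proof -
    obtain M N where MN: "M \<in> abelian_feet G" "x \<in> M" "N \<in> abelian_feet G" "y \<in> N"
      using xy by blast
    show ?thesis
    proof (cases "M = N")
      case True
      have "subgroup M G" using MN sub feet_subgroup by blast
      moreover have "comm_group (G\<lparr>carrier := M\<rparr>)" using MN by (simp add: abelian_feet_def)
      ultimately show ?thesis using comm_group_subgroup_iff True MN by blast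
    next
      case False
      then show ?thesis using distinct_feet_commute MN sub by blast
    qed
  qed
  \<comment> \<open>\<open>generate_commutes\<close> is applied twice: it extends the second factor
    from generators to the span, then the first.\<close>
  have "x \<otimes> y = y \<otimes> x" if "x \<in> ?U" "y \<in> generate G ?U" for x y
    using generate_commutes[OF U, of x y] comm that U by auto
  then have "x \<otimes> y = y \<otimes> x" if "x \<in> generate G ?U" "y \<in> generate G ?U" for x y
    using generate_commutes[OF U, of y x] that U generate_in_carrier[OF U] by auto
  then show ?thesis
    using comm_group_subgroup_iff[OF generate_is_subgroup[OF U]] unfolding MA_def by blast
qed

text \<open>This makes all nonabelian feet independent at once, with no choice of a subfamily.
  Applied inside a foot \<open>H\<close>, it also yields conjugacy of the feet of
  \<open>H\<close>.\<close>

lemma (in group) noncomm_foot_Int_generate: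
  assumes M: "M \<in> feet G" "\<not> comm_group (G\<lparr>carrier := M\<rparr>)" and \<S>: "\<S> \<subseteq> feet G" "M \<notin> \<S>"
  shows "M \<inter> generate G (\<Union>\<S>) = {\<one>}"
proof (rule ccontr)
  assume not: "M \<inter> generate G (\<Union>\<S>) \<noteq> {\<one>}"
  have "generate G (\<Union>\<S>) \<lhd> G" using \<S> by (intro normal_generate_Union) (auto intro: feet_normal)
  then have MS: "M \<subseteq> generate G (\<Union>\<S>)" using not foot_Int_normal[OF M(1)] by blast
  have sub: "subgroup M G" by (rule feet_subgroup[OF M(1)])
  have "y \<otimes> z = z \<otimes> y" if "y \<in> M" "z \<in> M" for y z
  proof (rule generate_commutes[OF feet_subset_carrier[OF \<S>(1)]])
    show "z \<in> carrier G" using that subgroup.mem_carrier[OF sub] by blast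
    show "y \<in> generate G (\<Union>\<S>)" using that MS by blast
    fix x assume "x \<in> \<Union>\<S>"
    then obtain N where "N \<in> \<S>" "x \<in> N" by blast
    then show "x \<otimes> z = z \<otimes> x" using distinct_feet_commute[of N M x z] \<S> M that by blast
  qed
  then show False using M(2) comm_group_subgroup_iff[OF sub] by blast
qed

text \<open>The centre of a normal subgroup is normal in the whole group. It is not all of
  \<open>M\<close>, since \<open>M\<close> is nonabelian, so minimality makes it trivial.\<close>

lemma (in group) noncomm_foot_center_trivial:
  assumes M: "M \<in> feet G" "\<not> comm_group (G\<lparr>carrier := M\<rparr>)"
    and x: "x \<in> M" "\<And>y. y \<in> M \<Longrightarrow> x \<otimes> y = y \<otimes> x"
  shows "x = \<one>"
proof -
  interpret M: normal M G by (rule feet_normal[OF M(1)])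
  define Z where "Z = {z \<in> M. \<forall>y\<in>M. z \<otimes> y = y \<otimes> z}"
  \<comment> \<open>Written as an intersection of \<open>M\<close> with centralizers, the centre is
    a subgroup because subgroups are closed under intersections.\<close>
  have Z_eq: "Z = M \<inter> \<Inter>((\<lambda>y. {z \<in> carrier G. z \<otimes> y = y \<otimes> z}) ` M)"
    using M.mem_carrier by (auto simp: Z_def)
  have "subgroup Z G"
    unfolding Z_eq
  proof (rule subgroups_Inter_pair)
    show "subgroup (\<Inter>((\<lambda>y. {z \<in> carrier G. z \<otimes> y = y \<otimes> z}) ` M)) G"
      using subgroup_elementwise_centralizer[OF M.mem_carrier] M.one_closed
      by (intro subgroups_Inter) blast+
  qed (rule M.subgroup_axioms)
  moreover have "g \<otimes> z \<otimes> inv g \<in> Z" if g: "g \<in> carrier G" and z: "z \<in> Z" for g z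
  proof -
    have zM: "z \<in> M" using z Z_def by auto
    have "(g \<otimes> z \<otimes> inv g) \<otimes> y = y \<otimes> (g \<otimes> z \<otimes> inv g)" if y: "y \<in> M" for y
    proof -
      \<comment> \<open>Normality of \<open>M\<close> lets \<open>y\<close> be conjugated back by
        \<open>g\<close> to an element of \<open>M\<close>, where centrality of \<open>z\<close>
        applies.\<close>
      have "inv g \<otimes> y \<otimes> g \<in> M" using M.inv_op_closed1 g y by blast
      then have eq: "z \<otimes> (inv g \<otimes> y \<otimes> g) = (inv g \<otimes> y \<otimes> g) \<otimes> z" using z Z_def by auto
      have c: "g \<in> carrier G" "z \<in> carrier G" "y \<in> carrier G" using g zM y M.mem_carrier by auto
      have "(g \<otimes> z \<otimes> inv g) \<otimes> y = g \<otimes> (z \<otimes> (inv g \<otimes> y \<otimes> g)) \<otimes> inv g"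
        using c by (simp add: m_assoc)
      also have "\<dots> = g \<otimes> ((inv g \<otimes> y \<otimes> g) \<otimes> z) \<otimes> inv g" using eq by simp
      also have "\<dots> = (g \<otimes> inv g) \<otimes> y \<otimes> (g \<otimes> z \<otimes> inv g)"
        using c by (simp only: m_assoc m_closed inv_closed)
      also have "\<dots> = y \<otimes> (g \<otimes> z \<otimes> inv g)"
        using c by simp
      finally show ?thesis .
    qed
    then show ?thesis using M.inv_op_closed2[OF g zM] by (simp add: Z_def)
  qed
  ultimately have "Z \<lhd> G" by (simp add: normal_inv_iff)
  moreover have "Z \<noteq> M"
    using M(2) comm_group_subgroup_iff[OF M.subgroup_axioms] unfolding Z_def by blast
  ultimately have "Z = {\<one>}" using M(1) unfolding feet_def Z_def by blast
  then show ?thesis using x Z_def by blast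
qed

text \<open>Induction on the set of feet. Write x = m k with m in the new foot \<open>M\<close> and
  k in the span of the old ones. As k commutes with \<open>M\<close>, the factor m is central in
  \<open>M\<close> and hence trivial, which leaves x = k in the smaller span.\<close>

lemma (in group) central_in_noncomm_feet_trivial:
  assumes "finite \<F>" "\<F> \<subseteq> feet G" "\<And>M. M \<in> \<F> \<Longrightarrow> \<not> comm_group (G\<lparr>carrier := M\<rparr>)"
    and "x \<in> generate G (\<Union>\<F>)" "\<And>y. y \<in> \<Union>\<F> \<Longrightarrow> x \<otimes> y = y \<otimes> x"
  shows "x = \<one>"
  using assms
proof (induction \<F> rule: finite_induct)
  case empty
  then show ?case by (simp add: generate_empty)
next
  case (insert M \<F>)
  let ?K = "generate G (\<Union>\<F>)"
  have MK: "M \<lhd> G" "?K \<lhd> G"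
    using insert.prems(1) by (auto intro!: normal_generate_Union intro: feet_normal)
  interpret M: normal M G by (fact MK)
  interpret K: normal ?K G by (fact MK)
  have "\<Union>(insert M \<F>) \<subseteq> M \<union> ?K" by (auto intro: generate.incl)
  then have "x \<in> M <#> ?K"
    using insert.prems(3) mono_generate generate_Un_normal_subset[OF MK] by (meson subsetD)
  then obtain m k where mk: "m \<in> M" "k \<in> ?K" "x = m \<otimes> k" unfolding set_mult_def by auto
  have c: "m \<in> carrier G" "k \<in> carrier G" using mk M.mem_carrier K.mem_carrier by auto
  have "m \<otimes> y = y \<otimes> m" if y: "y \<in> M" for y
  proof -
    have yc: "y \<in> carrier G" using y M.mem_carrier by auto
    have "k \<otimes> y = y \<otimes> k"
    proof (rule generate_commutes[OF _ yc _ mk(2)])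
      show "\<Union>\<F> \<subseteq> carrier G" using feet_subset_carrier insert.prems by blast
      fix z assume "z \<in> \<Union>\<F>"
      then obtain N where N: "N \<in> \<F>" "z \<in> N" by blast
      then have "N \<noteq> M" using insert.hyps by blast
      then show "z \<otimes> y = y \<otimes> z"
        using distinct_feet_commute[of N M z y] N y insert.prems(1) by blast
    qed
    moreover have "m \<otimes> k \<otimes> y = y \<otimes> (m \<otimes> k)" using insert.prems(4)[of y] y mk(3) by blast
    ultimately have "m \<otimes> y \<otimes> k = y \<otimes> m \<otimes> k" using c yc by (simp add: m_assoc)
    then show ?thesis using c yc by simp
  qed
  then have "m = \<one>"
    using noncomm_foot_center_trivial[of M m] insert.prems mk by blast
  then have "x = k" using mk c by simp
  then show ?case
    using insert.IH insert.prems mk by blast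
qed

section \<open>Transport of feet along isomorphisms, and existence of feet\<close>

text \<open>Conjugation by an element of the ambient group need not be inner on a normal subgroup
  \<open>H\<close>, so feet of \<open>H\<close> are carried along as under an arbitrary
  automorphism. Minimality is checked by pulling a competing normal subgroup back along the
  inverse.\<close>

lemma iso_image_feet:
  assumes \<phi>: "\<phi> \<in> iso G K" "group G" "group K" and S: "S \<in> feet G"
  shows "\<phi> ` S \<in> feet K"
proof -
  interpret G: group G by fact
  interpret K: group K by fact
  interpret h: group_hom G K \<phi>
    by unfold_locales (use \<phi>(1) in \<open>simp add: iso_def\<close>)
  have inj: "inj_on \<phi> (carrier G)" using \<phi>(1) by (simp add: iso_def bij_betw_def)
  have SG: "S \<subseteq> carrier G" using S feet_subset by blast
  obtain \<psi> where \<psi>: "\<psi> \<in> iso K G" "\<And>x. x \<in> carrier G \<Longrightarrow> \<psi> (\<phi> x) = x"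
    "\<And>y. y \<in> carrier K \<Longrightarrow> \<phi> (\<psi> y) = y"
  proof
    show "inv_into (carrier G) \<phi> \<in> iso K G" using G.iso_set_sym[OF \<phi>(1)] .
  qed (use \<phi>(1) in \<open>auto simp: iso_def bij_betw_def inv_into_f_f f_inv_into_f\<close>)
  show ?thesis
    unfolding feet_def
  proof (intro CollectI conjI allI impI)
    show "\<phi> ` S \<lhd> K" by (rule iso_normal_subgroup[OF \<phi> feet_normal[OF S]])
    have "\<one>\<^bsub>G\<^esub> \<in> S" using S subgroup.one_closed[OF feet_subgroup] by blast
    moreover have "S \<noteq> {\<one>\<^bsub>G\<^esub>}" using S by (simp add: feet_def)
    ultimately obtain s where s: "s \<in> S" "s \<noteq> \<one>\<^bsub>G\<^esub>" by blast
    then have "\<phi> s \<noteq> \<one>\<^bsub>K\<^esub>"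
      using inj SG by (metis G.one_closed h.hom_one inj_onD subsetD)
    then show "\<phi> ` S \<noteq> {\<one>\<^bsub>K\<^esub>}" using s by blast
    fix N assume N: "N \<lhd> K" "N \<subseteq> \<phi> ` S"
    have NK: "N \<subseteq> carrier K" by (rule subgroup.subset[OF normal_imp_subgroup[OF N(1)]])
    have "\<psi> ` N \<lhd> G" by (rule iso_normal_subgroup[OF \<psi>(1) \<phi>(3,2) N(1)])
    moreover have "\<psi> ` N \<subseteq> S" using N(2) \<psi>(2) SG by force
    ultimately have "\<psi> ` N = S \<or> \<psi> ` N = {\<one>\<^bsub>G\<^esub>}" using S by (simp add: feet_def)
    moreover have "\<phi> ` \<psi> ` N = N"
      using NK \<psi>(3) by (simp add: image_image subset_iff)
    ultimately show "N = \<phi> ` S \<or> N = {\<one>\<^bsub>K\<^esub>}"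
      by auto
  qed
qed

text \<open>A nontrivial normal subgroup of least cardinality is minimal under inclusion.\<close>

lemma finite_group_has_foot:
  assumes "group G" "finite (carrier G)" "carrier G \<noteq> {\<one>\<^bsub>G\<^esub>}"
  shows "feet G \<noteq> {}"
proof -
  interpret group G by fact
  define P where "P N \<longleftrightarrow> N \<lhd> G \<and> N \<noteq> {\<one>\<^bsub>G\<^esub>}" for N
  have "P (carrier G)" using assms normal_self by (simp add: P_def)
  then obtain M where M: "P M" "\<And>N. P N \<Longrightarrow> card M \<le> card N"
    using ex_has_least_nat[of P "carrier G" card] by blast
  have "M \<subseteq> carrier G"
    using M(1) by (intro subgroup.subset normal_imp_subgroup) (simp add: P_def)
  then have fin: "finite M" using assms finite_subset by blast
  have "N = M \<or> N = {\<one>\<^bsub>G\<^esub>}" if "N \<lhd> G" "N \<subseteq> M" for N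
    using M(2)[of N] that card_seteq[OF fin, of N] by (auto simp: P_def)
  then have "M \<in> feet G" using M(1) unfolding feet_def P_def by simp
  then show ?thesis by blast
qed

lemma (in group) conjugation_iso:
  assumes "H \<lhd> G" "g \<in> carrier G"
  shows "(\<lambda>x. g \<otimes> x \<otimes> inv g) \<in> iso (G\<lparr>carrier := H\<rparr>) (G\<lparr>carrier := H\<rparr>)"
proof -
  interpret H: normal H G by fact
  have c: "x \<in> carrier G" if "x \<in> H" for x using that by (rule H.mem_carrier)
  have "g \<otimes> (x \<otimes> y) \<otimes> inv g = (g \<otimes> x \<otimes> inv g) \<otimes> (g \<otimes> y \<otimes> inv g)"
    if "x \<in> H" "y \<in> H" for x y
  proof -
    have "(g \<otimes> x \<otimes> inv g) \<otimes> (g \<otimes> y \<otimes> inv g) = g \<otimes> x \<otimes> (inv g \<otimes> g) \<otimes> y \<otimes> inv g"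
      using c[OF that(1)] c[OF that(2)] assms(2) by (simp only: m_assoc m_closed inv_closed)
    then show ?thesis using c[OF that(1)] c[OF that(2)] assms(2) by (simp add: m_assoc)
  qed
  moreover have "bij_betw (\<lambda>x. g \<otimes> x \<otimes> inv g) H H"
  proof (rule bij_betw_byWitness[where f' = "\<lambda>x. inv g \<otimes> x \<otimes> g"])
    show "\<forall>x\<in>H. inv g \<otimes> (g \<otimes> x \<otimes> inv g) \<otimes> g = x"
      using c assms(2) by (simp add: m_assoc) (simp add: m_assoc[symmetric])
    show "\<forall>x\<in>H. g \<otimes> (inv g \<otimes> x \<otimes> g) \<otimes> inv g = x"
      using c assms(2) by (simp add: m_assoc) (simp add: m_assoc[symmetric])
  qed (use assms(2) H.inv_op_closed1 H.inv_op_closed2 in auto)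
  ultimately show ?thesis
    using H.inv_op_closed2 assms(2) by (auto simp: iso_def hom_def)
qed

section \<open>Finite elementary abelian groups as powers of \<open>additive_F p\<close>\<close>

lemma carrier_additive_F [simp]: "carrier (additive_F p) = {0..int p - 1}"
  and mult_additive_F [simp]: "x \<otimes>\<^bsub>additive_F p\<^esub> y = (x + y) mod int p"
  and one_additive_F [simp]: "\<one>\<^bsub>additive_F p\<^esub> = 0"
  by (simp_all add: additive_F_def residue_ring_def)

lemma group_additive_F:
  assumes "p > 1"
  shows "group (additive_F p)"
proof -
  have "residues (int p)" using assms by (simp add: residues_def)
  then show ?thesis
    unfolding additive_F_def by (rule abelian_group.a_group[OF residues.abelian_group])
qed

text \<open>The inductive step of a dimension count: an element outside the image of
  \<open>h\<close> contributes one more coordinate, used as its exponent. Injectivity survives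
  because a nonzero exponent is invertible modulo p, so a nontrivial relation would put
  \<open>a\<close> into the image.\<close>

lemma (in comm_group) extend_mon_from_powers_of_F:
  fixes p n :: nat
  assumes p: "Factorial_Ring.prime p" and a: "a \<in> carrier G" "a [^] p = \<one>"
    and h: "h \<in> mon (product_group {..<n} (\<lambda>_. additive_F p)) G"
    and a_notin: "a \<notin> h ` carrier (product_group {..<n} (\<lambda>_. additive_F p))"
  shows "(\<lambda>f. h (restrict f {..<n}) \<otimes> a [^] f n)
    \<in> mon (product_group {..<Suc n} (\<lambda>_. additive_F p)) G"
proof -
  let ?P = "\<lambda>n::nat. product_group {..<n} (\<lambda>_. additive_F p)"
  let ?h' = "\<lambda>f. h (restrict f {..<n}) \<otimes> a [^] (f n :: int)"
  have p1: "p > 1" using p by (rule prime_gt_1_nat)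
  have P: "group (?P m)" for m by (intro product_group group_additive_F p1)
  interpret h: group_hom "?P n" G h
    using h P[of n] by (simp add: group_hom_def group_hom_axioms_def mon_def)
  have res: "restrict f {..<n} \<in> carrier (?P n)" if "f \<in> carrier (?P (Suc n))" for f
    using that by (auto simp: PiE_iff)
  \<comment> \<open>The order of \<open>a\<close> divides p, so exponents may be reduced modulo p,
    as addition in \<open>additive_F p\<close> does.\<close>
  have amod: "a [^] (k mod int p) = a [^] k" for k :: int
  proof -
    have "int (ord a) dvd int p" using a pow_eq_id by auto
    then have "int (ord a) dvd k - k mod int p"
      by (meson dvd_trans dvd_minus_mod)
    then show ?thesis using int_pow_eq a(1) by blast
  qed
  have hom: "?h' \<in> hom (?P (Suc n)) G"
  proof (rule homI)
    fix f assume f: "f \<in> carrier (?P (Suc n))"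
    show "?h' f \<in> carrier G" using h.hom_closed[OF res[OF f]] a by simp
  next
    fix f g assume f: "f \<in> carrier (?P (Suc n))" and g: "g \<in> carrier (?P (Suc n))"
    have "restrict (f \<otimes>\<^bsub>?P (Suc n)\<^esub> g) {..<n} = restrict f {..<n} \<otimes>\<^bsub>?P n\<^esub> restrict g {..<n}"
      by (auto simp: fun_eq_iff restrict_def)
    moreover have "(f \<otimes>\<^bsub>?P (Suc n)\<^esub> g) n = (f n + g n) mod int p" by simp
    ultimately have "?h' (f \<otimes>\<^bsub>?P (Suc n)\<^esub> g)
        = (h (restrict f {..<n}) \<otimes> h (restrict g {..<n})) \<otimes> (a [^] f n \<otimes> a [^] g n)"
      using h.hom_mult[OF res[OF f] res[OF g]] a amod by (simp only: int_pow_mult)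
    also have "\<dots> = ?h' f \<otimes> ?h' g"
      using h.hom_closed[OF res[OF f]] h.hom_closed[OF res[OF g]] a(1)
      by (simp only: m_ac m_closed int_pow_closed)
    finally show "?h' (f \<otimes>\<^bsub>?P (Suc n)\<^esub> g) = ?h' f \<otimes> ?h' g" .
  qed
  interpret h': group_hom "?P (Suc n)" G ?h'
    using hom P[of "Suc n"] by (simp add: group_hom_def group_hom_axioms_def)
  have "f = \<one>\<^bsub>?P (Suc n)\<^esub>" if f: "f \<in> carrier (?P (Suc n))" and "?h' f = \<one>" for f
  proof -
    let ?b = "h (restrict f {..<n})"
    have b: "?b \<in> carrier G" using h.hom_closed[OF res[OF f]] .
    have fn: "0 \<le> f n" "f n < int p" using f by (auto simp: PiE_iff)
    have apow: "a [^] f n = inv ?b"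
      using \<open>?h' f = \<one>\<close> a b by (metis inv_equality int_pow_closed m_comm)
    have f0: "f n = 0"
    proof (rule ccontr)
      assume "f n \<noteq> 0"
      then have "coprime (f n) (int p)"
        using fn p by (metis coprime_commute linorder_not_less order_le_less prime_imp_coprime
            prime_int_nat_transfer prime_nat_int_transfer zdvd_imp_le)
      \<comment> \<open>The inverse \<open>u\<close> of the exponent modulo p recovers
        \<open>a\<close> from \<open>a [^] f n\<close>, which lies in the image of
        \<open>h\<close>.\<close>
      then obtain u where "[f n * u = 1] (mod int p)" using cong_solve_coprime_int by blast
      then have "a [^] (f n * u) = a [^] (1::int)"
        using amod unfolding cong_def by metis
      then have "a = (inv ?b) [^] u" using a apow by (simp flip: int_pow_pow)
      moreover have "?b \<in> h ` carrier (?P n)" using res[OF f] by blast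
      ultimately have "a \<in> h ` carrier (?P n)"
        using h.img_is_subgroup by (metis subgroup.m_inv_closed subgroup_int_pow_closed)
      then show False using a_notin by blast
    qed
    then have "inv ?b = \<one>" using apow by simp
    then have "?b = \<one>" using b inv_eq_1_iff by blast
    then have "restrict f {..<n} = \<one>\<^bsub>?P n\<^esub>"
      using h res[OF f] h.inj_on_one_iff by (auto simp: mon_def)
    then have "f i = 0" if "i < n" for i
      using that by (simp add: fun_eq_iff restrict_def) metis
    with f0 f show ?thesis
      by (auto simp: fun_eq_iff PiE_iff extensional_def less_Suc_eq)
  qed
  then show ?thesis using hom h'.inj_on_one_iff by (simp add: mon_def)
qed

text \<open>Take the greatest \<open>n\<close> for which the power with \<open>n\<close> factors
  embeds. An embedding for this \<open>n\<close> is onto, since an element outside its image would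
  give an embedding for \<open>Suc n\<close>.\<close>

lemma (in comm_group) elementary_abelian_iso_power_of_F:
  fixes p :: nat
  assumes p: "Factorial_Ring.prime p" and fin: "finite (carrier G)"
    and exp: "\<And>a. a \<in> carrier G \<Longrightarrow> a [^] p = \<one>"
  shows "\<exists>n::nat. G \<cong> product_group {..<n} (\<lambda>_. additive_F p)"
proof -
  let ?P = "\<lambda>n::nat. product_group {..<n} (\<lambda>_. additive_F p)"
  have p1: "p > 1" using p by (rule prime_gt_1_nat)
  have P: "group (?P m)" for m by (intro product_group group_additive_F p1)
  define Q where "Q n \<longleftrightarrow> mon (?P n) G \<noteq> {}" for n
  \<comment> \<open>The product over no factors has a single element, so the constant map is
    injective; this makes the set of admissible \<open>n\<close> nonempty.\<close>
  have "(\<lambda>_. \<one>) \<in> mon (?P 0) G" by (auto simp: mon_def hom_def)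
  then have Q0: "Q 0" unfolding Q_def by blast
  have bound: "n \<le> card (carrier G)" if Qn: "Q n" for n
  proof -
    obtain h where h: "h \<in> hom (?P n) G" "inj_on h (carrier (?P n))"
      using Qn unfolding Q_def mon_def by blast
    have "card (carrier (?P n)) = p ^ n" by (simp add: card_PiE)
    moreover have "card (carrier (?P n)) \<le> card (carrier G)"
      using h fin by (intro card_inj_on_le) (auto simp: hom_def)
    \<comment> \<open>Turns the comparison of cardinalities into a bound on \<open>n\<close> itself,
      as needed for a greatest \<open>n\<close> to exist.\<close>
    moreover have "n < p ^ n" using p1 by (simp add: power_gt_expt)
    ultimately show ?thesis by linarith
  qed
  obtain n where n: "Q n" "\<And>m. Q m \<Longrightarrow> m \<le> n"
    using Q0 bound GreatestI_nat[of Q 0 "card (carrier G)"] Greatest_le_nat[of Q _ "card (carrier G)"]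
    by blast
  then obtain h where h: "h \<in> mon (?P n) G" unfolding Q_def by blast
  have "carrier G \<subseteq> h ` carrier (?P n)"
  proof
    fix a assume a: "a \<in> carrier G"
    show "a \<in> h ` carrier (?P n)"
    proof (rule ccontr)
      assume "a \<notin> h ` carrier (?P n)"
      from extend_mon_from_powers_of_F[OF p a exp[OF a] h this] have "Q (Suc n)"
        unfolding Q_def by blast
      then show False using n(2)[of "Suc n"] by simp
    qed
  qed
  then have "h \<in> iso (?P n) G"
    using h by (auto simp: iso_def mon_def bij_betw_def hom_def)
  then have "?P n \<cong> G" unfolding is_iso_def by blast
  then show ?thesis using group.iso_sym[OF P] by blast
qed

section \<open>Abelian feet\<close>

text \<open>The elements of \<open>A\<close> killed by p form a normal subgroup of the whole group:
  commutativity of \<open>A\<close> gives closure under products, and conjugation preserves p-th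
  powers. When p divides the order of some element this subgroup is nontrivial, so minimality makes
  it all of \<open>A\<close>.\<close>

lemma (in group) abelian_foot_prime_exponent:
  assumes A: "A \<in> abelian_feet G"
  obtains p :: nat where "Factorial_Ring.prime p" "\<And>a. a \<in> A \<Longrightarrow> a [^] p = \<one>"
proof -
  have A': "A \<in> feet G" "finite A" "comm_group (G\<lparr>carrier := A\<rparr>)"
    using A by (auto simp: abelian_feet_def finite_feet_def)
  interpret A: normal A G by (rule feet_normal[OF A'(1)])
  interpret GA: comm_group "G\<lparr>carrier := A\<rparr>" by (rule A'(3))
  obtain a where a: "a \<in> A" "a \<noteq> \<one>" using A'(1) A.one_closed unfolding feet_def by blast
  have pow: "x [^]\<^bsub>G\<lparr>carrier := A\<rparr>\<^esub> n = x [^] n" for x and n :: nat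
    by (rule nat_pow_consistent[symmetric])
  define n where "n = GA.ord a"
  have n: "n \<ge> 1" "n \<noteq> 1"
    using GA.ord_ge_1[of a] GA.ord_eq_1[of a] a A'(2) by (auto simp: n_def)
  then obtain p :: nat where p: "Factorial_Ring.prime p" "p dvd n" using prime_factor_nat by blast
  \<comment> \<open>A power of \<open>a\<close> killed by p; it is nontrivial because 0 < n div p <
    n, with \<open>n\<close> the order of \<open>a\<close>.\<close>
  define b where "b = a [^] (n div p)"
  have b: "b \<in> A" using GA.nat_pow_closed[of a "n div p"] a by (simp add: b_def pow)
  have "\<not> n dvd n div p"
    using n p by (metis One_nat_def Suc_le_lessD div_less_dividend dvd_imp_le dvd_div_eq_0_iff
        gr0I not_less prime_gt_1_nat)
  then have b1: "b \<noteq> \<one>"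
    using GA.pow_eq_id[of a "n div p"] a by (simp add: b_def pow n_def)
  have bp: "b [^] p = \<one>"
    using GA.pow_ord_eq_1[of a] a p(2) A.mem_carrier by (simp add: b_def pow n_def nat_pow_pow)
  define T where "T = {x \<in> A. x [^] p = \<one>}"
  have "subgroup T G"
  proof (rule subgroupI)
    fix x assume x: "x \<in> T"
    show "inv x \<in> T" using x A.mem_carrier by (auto simp: T_def nat_pow_inv)
    fix y assume y: "y \<in> T"
    show "x \<otimes> y \<in> T"
      using x y GA.nat_pow_distrib[of x y p] by (auto simp: T_def pow)
  qed (use A.mem_carrier b bp in \<open>auto simp: T_def\<close>)
  moreover have "g \<otimes> x \<otimes> inv g \<in> T" if g: "g \<in> carrier G" and x: "x \<in> T" for g x
  proof -
    have "(g \<otimes> x \<otimes> inv g) [^] p = g \<otimes> x [^] p \<otimes> inv g"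
      using hom_nat_pow[of "\<lambda>x. g \<otimes> x \<otimes> inv g" "G\<lparr>carrier := A\<rparr>" "G\<lparr>carrier := A\<rparr>" x p]
        conjugation_iso[OF A.normal_axioms g] x GA.group_axioms
      by (simp add: T_def pow iso_def)
    then show ?thesis using g x A.inv_op_closed2 by (simp add: T_def)
  qed
  ultimately have "T \<lhd> G" by (simp add: normal_inv_iff)
  moreover have "T \<subseteq> A" "T \<noteq> {\<one>}" using b b1 bp by (auto simp: T_def)
  ultimately have "T = A" using A'(1) by (auto simp: feet_def)
  then show thesis using that[OF p(1)] by (auto simp: T_def)
qed

lemma (in group) abelian_foot_iso_power_of_F:
  assumes A: "A \<in> abelian_feet G"
  shows "\<exists>p n. Factorial_Ring.prime p \<and> n > 0 \<and>
    G\<lparr>carrier := A\<rparr> \<cong> product_group {..<n::nat} (\<lambda>_. additive_F p)"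
proof -
  obtain p :: nat where p: "Factorial_Ring.prime p" "\<And>a. a \<in> A \<Longrightarrow> a [^] p = \<one>"
    using abelian_foot_prime_exponent[OF A] by blast
  have A': "A \<in> feet G" "finite A" "comm_group (G\<lparr>carrier := A\<rparr>)"
    using A by (auto simp: abelian_feet_def finite_feet_def)
  obtain n :: nat where n: "G\<lparr>carrier := A\<rparr> \<cong> product_group {..<n} (\<lambda>_. additive_F p)"
    using comm_group.elementary_abelian_iso_power_of_F[OF A'(3) p(1)] A'(2) p(2)
    by (auto simp flip: nat_pow_consistent)
  \<comment> \<open>A product over no factors would make \<open>A\<close> trivial, against the
    definition of a foot.\<close>
  have "n \<noteq> 0"
  proof
    assume "n = 0"
    then have "card A = 1" using iso_same_card[OF n] by simp
    moreover have "\<one> \<in> A" by (rule subgroup.one_closed[OF feet_subgroup[OF A'(1)]])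
    ultimately have "A = {\<one>}" by (metis card_1_singletonE singletonD)
    then show False using A'(1) by (simp add: feet_def)
  qed
  then show ?thesis using p(1) n by blast
qed

section \<open>Feet inside a nonabelian foot\<close>

lemma (in group) conjugates_of_foot_generate:
  assumes H: "H \<in> feet G" and S: "S \<in> feet (G\<lparr>carrier := H\<rparr>)"
  shows "generate G (\<Union>g\<in>carrier G. (\<lambda>s. g \<otimes> s \<otimes> inv g) ` S) = H"
proof -
  let ?U = "\<Union>g\<in>carrier G. (\<lambda>s. g \<otimes> s \<otimes> inv g) ` S"
  interpret H: normal H G by (rule feet_normal[OF H])
  have SH: "S \<subseteq> H" using feet_subset[OF S] by simp
  have UH: "?U \<subseteq> H" using SH H.inv_op_closed2 by auto
  have "generate G ?U \<lhd> G"
  proof (rule normal_generateI)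
    show "?U \<subseteq> carrier G" using UH H.subset by blast
    fix h k assume h: "h \<in> ?U" and k: "k \<in> carrier G"
    then obtain g s where gs: "g \<in> carrier G" "s \<in> S" "h = g \<otimes> s \<otimes> inv g" by blast
    \<comment> \<open>Conjugation by \<open>k\<close> permutes the conjugates of \<open>S\<close>,
      so their union is stable.\<close>
    then have "k \<otimes> h \<otimes> inv k = (k \<otimes> g) \<otimes> s \<otimes> inv (k \<otimes> g)"
      using k SH H.mem_carrier by (auto simp: inv_mult_group m_assoc)
    then show "k \<otimes> h \<otimes> inv k \<in> ?U" using gs k by blast
  qed
  moreover have "generate G ?U \<subseteq> H" by (rule generate_subgroup_incl[OF UH H.subgroup_axioms])
  moreover have "generate G ?U \<noteq> {\<one>}"
  proof
    assume triv: "generate G ?U = {\<one>}"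
    have "s = \<one>" if "s \<in> S" for s
    proof -
      have "s = \<one> \<otimes> s \<otimes> inv \<one>" using that SH H.mem_carrier by auto
      then have "s \<in> ?U" by (intro UN_I[OF one_closed] image_eqI[OF _ that])
      then show ?thesis using triv generate.incl[of s ?U G] by blast
    qed
    moreover have "\<one> \<in> S" using subgroup.one_closed[OF feet_subgroup[OF S]] by simp
    ultimately have "S = {\<one>}" by blast
    then show False using S by (simp add: feet_def)
  qed
  ultimately show ?thesis using H unfolding feet_def by blast
qed

text \<open>Every other foot commutes with \<open>S\<close>, so a normal subgroup of \<open>S\<close> is normal in the whole group.\<close>

lemma (in group) foot_simple:
  assumes gen: "generate G (\<Union>(feet G)) = carrier G" and S: "S \<in> feet G" "finite S"
  shows "simple_group (G\<lparr>carrier := S\<rparr>)"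
proof -
  interpret S: normal S G by (rule feet_normal[OF S(1)])
  let ?K = "generate G (\<Union>(feet G - {S}))"
  have K: "?K \<lhd> G" by (rule normal_generate_Union) (auto intro: feet_normal)
  interpret K: normal ?K G by (rule K)
  have "N = S \<or> N = {\<one>}" if N: "N \<lhd> G\<lparr>carrier := S\<rparr>" for N
  proof -
    interpret N: normal N "G\<lparr>carrier := S\<rparr>" by (rule N)
    have NS: "N \<subseteq> S" using N.subset by simp
    have "subgroup N G" by (rule incl_subgroup[OF S.subgroup_axioms N.subgroup_axioms])
    moreover have "g \<otimes> x \<otimes> inv g \<in> N" if g: "g \<in> carrier G" and x: "x \<in> N" for g x
    proof -
      \<comment> \<open>Factor \<open>g\<close> into an element of \<open>S\<close> and one of the
        span of the other feet. The second factor centralizes \<open>S\<close>, so \<open>g\<close>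
        acts on \<open>x\<close> as its first factor does, and normality of \<open>N\<close> in
        \<open>S\<close> applies.\<close>
      have "\<Union>(feet G) \<subseteq> S \<union> ?K" by (auto intro: generate.incl)
      then have "g \<in> S <#> ?K"
        using g gen mono_generate[of "\<Union>(feet G)" "S \<union> ?K"]
          generate_Un_normal_subset[OF S.normal_axioms K] by blast
      then obtain s k where sk: "s \<in> S" "k \<in> ?K" "g = s \<otimes> k" unfolding set_mult_def by auto
      have c: "s \<in> carrier G" "k \<in> carrier G" "x \<in> carrier G"
        using sk S.mem_carrier K.mem_carrier x NS by auto
      have "k \<otimes> x = x \<otimes> k"
      proof (rule generate_commutes[OF _ c(3) _ sk(2)])
        show "\<Union>(feet G - {S}) \<subseteq> carrier G" by (intro feet_subset_carrier) auto
        fix z assume "z \<in> \<Union>(feet G - {S})"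
        then obtain M where "M \<in> feet G" "M \<noteq> S" "z \<in> M" by blast
        then show "z \<otimes> x = x \<otimes> z" using distinct_feet_commute[OF _ S(1)] x NS by auto
      qed
      then have "k \<otimes> x \<otimes> inv k = x" using c by (simp add: m_assoc)
      have "g \<otimes> x \<otimes> inv g = s \<otimes> (k \<otimes> x \<otimes> inv k) \<otimes> inv s"
        using c sk(3) by (simp add: inv_mult_group m_assoc)
      also have "\<dots> = s \<otimes> x \<otimes> inv s" using \<open>k \<otimes> x \<otimes> inv k = x\<close> by simp
      finally show ?thesis
        using N.inv_op_closed2[of s x] sk(1) x m_inv_consistent[OF S.subgroup_axioms sk(1)] by simp
    qed
    ultimately have "N \<lhd> G" by (simp add: normal_inv_iff)
    then show ?thesis using S(1) NS by (auto simp: feet_def)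
  qed
  \<comment> \<open>\<open>simple_group\<close> demands order greater than one, and
    \<open>card\<close> is zero on infinite sets, so finiteness of \<open>S\<close> enters
    here.\<close>
  moreover have "order (G\<lparr>carrier := S\<rparr>) > 1"
  proof -
    have "S \<noteq> {\<one>}" using S(1) by (simp add: feet_def)
    then have "card S \<noteq> 1" using S.one_closed by (metis card_1_singletonE singletonD)
    moreover have "card S \<noteq> 0" using S.one_closed S(2) by (metis card_0_eq empty_iff)
    ultimately show ?thesis by (simp add: order_def)
  qed
  ultimately show ?thesis
    using subgroup_imp_group[OF S.subgroup_axioms]
    by (simp add: simple_group_def simple_group_axioms_def)
qed

text \<open>All three claims use that the conjugates of one foot \<open>S\<close> are feet of
  \<open>H\<close> spanning \<open>H\<close>. If \<open>S\<close> were abelian, so would be its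
  conjugates, and \<open>H\<close> would lie in the abelian group \<open>MA K\<close>. A foot
  \<open>T\<close> outside the conjugates would meet their span \<open>H\<close> trivially. For the
  last claim, some \<open>S\<close> exists because \<open>H\<close> is finite.\<close>

lemma (in group) feet_of_noncomm_foot:
  assumes H: "H \<in> nonabelian_feet G"
  defines "K \<equiv> G\<lparr>carrier := H\<rparr>"
  shows feet_of_noncomm_foot_noncomm: "S \<in> feet K \<Longrightarrow> \<not> comm_group (K\<lparr>carrier := S\<rparr>)"
    and feet_of_noncomm_foot_conjugate:
      "S \<in> feet K \<Longrightarrow> T \<in> feet K \<Longrightarrow> conjugate_in G S T"
    and feet_of_noncomm_foot_generate: "generate K (\<Union>(feet K)) = H"
proof -
  have H': "H \<in> feet G" "finite H" "\<not> comm_group (G\<lparr>carrier := H\<rparr>)"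
    using H by (auto simp: nonabelian_feet_def abelian_feet_def finite_feet_def)
  interpret H: normal H G by (rule feet_normal[OF H'(1)])
  interpret K: group K unfolding K_def by (rule subgroup_imp_group[OF H.subgroup_axioms])
  let ?c = "\<lambda>g s. g \<otimes> s \<otimes> inv g"
  have iso: "?c g \<in> iso K K" if "g \<in> carrier G" for g
    unfolding K_def by (rule conjugation_iso[OF H.normal_axioms that])
  have conj: "?c g ` S \<in> feet K" if "S \<in> feet K" "g \<in> carrier G" for S g
    by (rule iso_image_feet[OF iso[OF that(2)] K.group_axioms K.group_axioms that(1)])
  have fin: "finite S" if "S \<in> feet K" for S
    using feet_subset[OF that] H'(2) finite_subset by (auto simp: K_def)
  have sub: "generate K U = generate G U" if "U \<subseteq> H" for U
    unfolding K_def by (rule generate_consistent[OF that H.subgroup_axioms])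
  have feetH: "\<Union>(feet K) \<subseteq> H" using K.feet_subset_carrier[of "feet K"] by (simp add: K_def)
  have gen: "generate K (\<Union>g\<in>carrier G. ?c g ` S) = H" if S: "S \<in> feet K" for S
  proof -
    have "(\<Union>g\<in>carrier G. ?c g ` S) \<subseteq> H" using conj[OF S] feetH by blast
    then show ?thesis
      using conjugates_of_foot_generate[OF H'(1)] S sub unfolding K_def by auto
  qed
  show noncomm: "\<not> comm_group (K\<lparr>carrier := S\<rparr>)" if S: "S \<in> feet K" for S
  proof
    assume "comm_group (K\<lparr>carrier := S\<rparr>)"
    then have comm: "\<forall>x\<in>S. \<forall>y\<in>S. x \<otimes>\<^bsub>K\<^esub> y = y \<otimes>\<^bsub>K\<^esub> x"
      using K.comm_group_subgroup_iff[OF feet_subgroup[OF S]] by blast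
    have "?c g ` S \<in> abelian_feet K" if g: "g \<in> carrier G" for g
    proof -
      have "?c g x \<otimes>\<^bsub>K\<^esub> ?c g y = ?c g y \<otimes>\<^bsub>K\<^esub> ?c g x" if xy: "x \<in> S" "y \<in> S" for x y
      proof -
        have "x \<in> carrier K" "y \<in> carrier K" using xy feet_subset[OF S] by auto
        moreover have "?c g \<in> hom K K" using iso[OF g] by (simp add: iso_def)
        ultimately show ?thesis
          using comm xy hom_mult[of "?c g" K K x y] hom_mult[of "?c g" K K y x] by simp
      qed
      then have "comm_group (K\<lparr>carrier := ?c g ` S\<rparr>)"
        using K.comm_group_subgroup_iff[OF feet_subgroup[OF conj[OF S g]]] by auto
      then show ?thesis
        using conj[OF S g] fin by (simp add: abelian_feet_def finite_feet_def)
    qed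
    then have "(\<Union>g\<in>carrier G. ?c g ` S) \<subseteq> \<Union>(abelian_feet K)" by blast
    from K.mono_generate[OF this] have "H \<subseteq> MA K" unfolding MA_def gen[OF S] .
    moreover have "subgroup (MA K) K"
      unfolding MA_def
      by (intro K.generate_is_subgroup K.feet_subset_carrier)
        (auto simp: abelian_feet_def finite_feet_def)
    ultimately have "\<forall>x\<in>H. \<forall>y\<in>H. x \<otimes>\<^bsub>K\<^esub> y = y \<otimes>\<^bsub>K\<^esub> x"
      using K.comm_group_MA K.comm_group_subgroup_iff[of "MA K"] by blast
    then show False
      using H'(3) comm_group_subgroup_iff[OF H.subgroup_axioms] by (simp add: K_def)
  qed
  show "conjugate_in G S T" if S: "S \<in> feet K" and T: "T \<in> feet K" for S T
  proof (rule ccontr)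
    assume "\<not> conjugate_in G S T"
    then have "T \<notin> (\<lambda>g. ?c g ` S) ` carrier G" unfolding conjugate_in_def by blast
    moreover have "(\<lambda>g. ?c g ` S) ` carrier G \<subseteq> feet K" using conj[OF S] by blast
    ultimately have "T \<inter> generate K (\<Union>g\<in>carrier G. ?c g ` S) = {\<one>\<^bsub>K\<^esub>}"
      using K.noncomm_foot_Int_generate[OF T noncomm[OF T]] by blast
    moreover have "T \<subseteq> H" using T feetH by blast
    ultimately have "T = {\<one>\<^bsub>K\<^esub>}" using gen[OF S] by blast
    then show False using T by (simp add: feet_def)
  qed
  show "generate K (\<Union>(feet K)) = H"
  proof
    show "generate K (\<Union>(feet K)) \<subseteq> H"
      using K.generate_incl[of "\<Union>(feet K)"] feetH by (simp add: K_def)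
    have "feet K \<noteq> {}"
      using finite_group_has_foot[OF K.group_axioms] H' by (simp add: K_def feet_def)
    then obtain S where S: "S \<in> feet K" by blast
    have "(\<Union>g\<in>carrier G. ?c g ` S) \<subseteq> \<Union>(feet K)" using conj[OF S] by blast
    from K.mono_generate[OF this] show "H \<subseteq> generate K (\<Union>(feet K))" unfolding gen[OF S] .
  qed
qed

text \<open>The decomposition is first obtained in the group \<open>H\<close> itself. On subsets of
  \<open>H\<close>, the subgroups generated in \<open>H\<close> and in the whole group coincide, so
  it transfers.\<close>

lemma (in group) internal_direct_sum_feet_of_noncomm_foot:
  assumes H: "H \<in> nonabelian_feet G"
  shows "internal_direct_sum G (feet (G\<lparr>carrier := H\<rparr>)) (\<lambda>S. S) H"
proof -
  have "H \<in> feet G" using H by (simp add: nonabelian_feet_def finite_feet_def)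
  then have sub: "subgroup H G" by (rule feet_subgroup)
  interpret K: group "G\<lparr>carrier := H\<rparr>" by (rule subgroup_imp_group[OF sub])
  let ?F = "feet (G\<lparr>carrier := H\<rparr>)"
  have "independent_family (G\<lparr>carrier := H\<rparr>) ?F"
    unfolding independent_family_def
    using feet_of_noncomm_foot_noncomm[OF H] by (intro ballI K.noncomm_foot_Int_generate) auto
  then have sum: "internal_direct_sum (G\<lparr>carrier := H\<rparr>) ?F (\<lambda>S. S) H"
    using K.internal_direct_sum_normal[of ?F] feet_normal[of _ "G\<lparr>carrier := H\<rparr>"]
      feet_of_noncomm_foot_generate[OF H] by auto
  have "\<Union>?F \<subseteq> H" using K.feet_subset_carrier[of ?F] by simp
  then have "generate (G\<lparr>carrier := H\<rparr>) U = generate G U" if "U \<subseteq> \<Union>?F" for U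
    using that by (intro generate_consistent sub) auto
  moreover have "\<Union>(?F - {S}) \<subseteq> \<Union>?F" for S by blast
  ultimately show ?thesis using sum unfolding internal_direct_sum_def by simp
qed

section \<open>Decomposition of the minisocle\<close>

text \<open>Elements of \<open>MA G\<close> commute with every nonabelian foot, since abelian and
  nonabelian feet are distinct. Finite support places an element of the intersection in the span of
  finitely many nonabelian feet, where centrality makes it trivial.\<close>

lemma (in group) MA_Int_MH: "MA G \<inter> MH G = {\<one>}"
proof -
  have feet: "abelian_feet G \<subseteq> feet G" "nonabelian_feet G \<subseteq> feet G"
    by (auto simp: abelian_feet_def nonabelian_feet_def finite_feet_def)
  have "x = \<one>" if x: "x \<in> MA G" "x \<in> MH G" for x
  proof -
    obtain \<F> where \<F>: "\<F> \<subseteq> nonabelian_feet G" "finite \<F>" "x \<in> generate G (\<Union>\<F>)"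
      using generate_Union_finite_support x(2) unfolding MH_def by metis
    show ?thesis
    proof (rule central_in_noncomm_feet_trivial[OF \<F>(2) _ _ \<F>(3)])
      show "\<F> \<subseteq> feet G" using \<F>(1) feet by blast
      show "\<not> comm_group (G\<lparr>carrier := M\<rparr>)" if "M \<in> \<F>" for M
        using that \<F>(1) by (auto simp: nonabelian_feet_def abelian_feet_def)
      fix y assume "y \<in> \<Union>\<F>"
      then obtain M where M: "M \<in> nonabelian_feet G" "y \<in> M" using \<F>(1) by blast
      then have yc: "y \<in> carrier G" using feet_subset_carrier[OF feet(2)] by blast
      show "x \<otimes> y = y \<otimes> x"
      proof (rule generate_commutes[OF feet_subset_carrier[OF feet(1)] yc])
        show "x \<in> generate G (\<Union>(abelian_feet G))" using x(1) by (simp add: MA_def)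
        fix z assume "z \<in> \<Union>(abelian_feet G)"
        then obtain A where A: "A \<in> abelian_feet G" "z \<in> A" by blast
        then have "A \<noteq> M" using M by (auto simp: nonabelian_feet_def)
        then show "z \<otimes> y = y \<otimes> z" using distinct_feet_commute[of A M z y] A M feet by blast
      qed
    qed
  qed
  then show ?thesis unfolding MA_def MH_def using generate.one by blast
qed

text \<open>Indexing by \<open>bool\<close> keeps the two summands apart even when both are trivial;
  a set of subgroups indexed by itself would merge them.\<close>

lemma (in group) internal_direct_sum_MS:
  "internal_direct_sum G (UNIV :: bool set) (\<lambda>b. if b then MA G else MH G) (MS G)"
proof -
  have normal: "MA G \<lhd> G" "MH G \<lhd> G" "MS G \<lhd> G"
    unfolding MA_def MH_def MS_def
    by (intro normal_generate_Union feet_normal;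
        simp add: abelian_feet_def nonabelian_feet_def finite_feet_def)+
  interpret MA: normal "MA G" G by (rule normal)
  interpret MH: normal "MH G" G by (rule normal)
  interpret MS: normal "MS G" G by (rule normal)
  have sub: "MA G \<subseteq> MS G" "MH G \<subseteq> MS G"
    unfolding MA_def MH_def MS_def
    by (intro mono_generate Union_mono; simp add: abelian_feet_def nonabelian_feet_def)+
  have gen: "generate G (MA G \<union> MH G) = MS G"
  proof
    show "generate G (MA G \<union> MH G) \<subseteq> MS G"
      using sub by (intro generate_subgroup_incl MS.subgroup_axioms) auto
    have "\<Union>(finite_feet G) \<subseteq> MA G \<union> MH G"
      unfolding MA_def MH_def by (auto simp: nonabelian_feet_def intro: generate.incl)
    then show "MS G \<subseteq> generate G (MA G \<union> MH G)"
      unfolding MS_def by (rule mono_generate)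
  qed
  \<comment> \<open>With two indices, the subgroup generated by the other members is just the other
    summand.\<close>
  have "UNIV - {True} = {False}" "UNIV - {False} = {True}" by auto
  moreover have "generate G (MA G) = MA G" "generate G (MH G) = MH G"
    using generate_subgroup_incl[OF subset_refl MA.subgroup_axioms]
      generate_subgroup_incl[OF subset_refl MH.subgroup_axioms] by (auto intro: generate.incl)
  ultimately show ?thesis
    using gen MA_Int_MH sub normal MS.subgroup_axioms normal_restrict_supergroup
    unfolding internal_direct_sum_def by (auto simp: UNIV_bool Un_commute Int_commute)
qed

theorem proposition1:
  fixes \<Gamma> :: "('a, 'b) monoid_scheme"
  assumes "group \<Gamma>"
  shows
    "(\<forall>A\<in>abelian_feet \<Gamma>. \<exists>p n. Factorial_Ring.prime p \<and> n > 0 \<and>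
        \<Gamma>\<lparr>carrier := A\<rparr> \<cong> product_group {..<n::nat} (\<lambda>_. additive_F p)) \<and>
     (\<exists>\<A>\<subseteq>abelian_feet \<Gamma>. internal_direct_sum \<Gamma> \<A> (\<lambda>A. A) (MA \<Gamma>)) \<and>
     comm_group (\<Gamma>\<lparr>carrier := MA \<Gamma>\<rparr>) \<and>
     (\<forall>H\<in>nonabelian_feet \<Gamma>.
        finite (feet (\<Gamma>\<lparr>carrier := H\<rparr>)) \<and>
        (\<forall>S\<in>feet (\<Gamma>\<lparr>carrier := H\<rparr>). \<forall>T\<in>feet (\<Gamma>\<lparr>carrier := H\<rparr>). conjugate_in \<Gamma> S T) \<and>
        (\<forall>S\<in>feet (\<Gamma>\<lparr>carrier := H\<rparr>). simple_group (\<Gamma>\<lparr>carrier := S\<rparr>)) \<and>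
        internal_direct_sum \<Gamma> (feet (\<Gamma>\<lparr>carrier := H\<rparr>)) (\<lambda>S. S) H) \<and>
     internal_direct_sum \<Gamma> (nonabelian_feet \<Gamma>) (\<lambda>H. H) (MH \<Gamma>) \<and>
     internal_direct_sum \<Gamma> (UNIV :: bool set) (\<lambda>b. if b then MA \<Gamma> else MH \<Gamma>) (MS \<Gamma>)"
proof -
  interpret group \<Gamma> by fact
  have feet: "abelian_feet \<Gamma> \<subseteq> feet \<Gamma>" "nonabelian_feet \<Gamma> \<subseteq> feet \<Gamma>"
    by (auto simp: abelian_feet_def nonabelian_feet_def finite_feet_def)
  have H: "finite (feet (\<Gamma>\<lparr>carrier := H\<rparr>)) \<and>
      (\<forall>S\<in>feet (\<Gamma>\<lparr>carrier := H\<rparr>). \<forall>T\<in>feet (\<Gamma>\<lparr>carrier := H\<rparr>). conjugate_in \<Gamma> S T) \<and>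
      (\<forall>S\<in>feet (\<Gamma>\<lparr>carrier := H\<rparr>). simple_group (\<Gamma>\<lparr>carrier := S\<rparr>)) \<and>
      internal_direct_sum \<Gamma> (feet (\<Gamma>\<lparr>carrier := H\<rparr>)) (\<lambda>S. S) H"
    if H: "H \<in> nonabelian_feet \<Gamma>" for H
  proof -
    have fin: "finite H" and "H \<in> feet \<Gamma>"
      using H by (auto simp: nonabelian_feet_def finite_feet_def)
    interpret K: group "\<Gamma>\<lparr>carrier := H\<rparr>"
      by (rule subgroup_imp_group[OF feet_subgroup[OF \<open>H \<in> feet \<Gamma>\<close>]])
    have sub: "feet (\<Gamma>\<lparr>carrier := H\<rparr>) \<subseteq> Pow H"
      using feet_subset[of _ "\<Gamma>\<lparr>carrier := H\<rparr>"] by auto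
    have "simple_group (\<Gamma>\<lparr>carrier := S\<rparr>)" if S: "S \<in> feet (\<Gamma>\<lparr>carrier := H\<rparr>)" for S
    proof -
      have "finite S" using S sub finite_subset[OF _ fin] by auto
      \<comment> \<open>The hypothesis of \<open>foot_simple\<close> that the feet span the group is
        available inside \<open>H\<close>.\<close>
      then show ?thesis
        using K.foot_simple[OF _ S] feet_of_noncomm_foot_generate[OF H] by simp
    qed
    moreover have "finite (feet (\<Gamma>\<lparr>carrier := H\<rparr>))"
      using sub fin by (meson finite_Pow_iff finite_subset)
    ultimately show ?thesis
      using feet_of_noncomm_foot_conjugate[OF H] internal_direct_sum_feet_of_noncomm_foot[OF H]
      by blast
  qed
  \<comment> \<open>The nonabelian feet are independent all together, so none has to be
    discarded.\<close>
  have "independent_family \<Gamma> (nonabelian_feet \<Gamma>)"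
    unfolding independent_family_def
    using feet(2) by (intro ballI noncomm_foot_Int_generate)
      (auto simp: nonabelian_feet_def abelian_feet_def)
  then have MH: "internal_direct_sum \<Gamma> (nonabelian_feet \<Gamma>) (\<lambda>H. H) (MH \<Gamma>)"
    unfolding MH_def using feet(2) feet_normal[of _ \<Gamma>]
    by (intro internal_direct_sum_normal) auto
  \<comment> \<open>Here a subfamily must be chosen: in F_2 x F_2 the three subgroups of order two
    are feet, and the span of any two contains the third.\<close>
  have MA: "\<exists>\<A>\<subseteq>abelian_feet \<Gamma>. internal_direct_sum \<Gamma> \<A> (\<lambda>A. A) (MA \<Gamma>)"
    unfolding MA_def by (rule feet_span_internal_direct_sum[OF feet(1)])
  show ?thesis
    by (intro conjI ballI abelian_foot_iso_power_of_F MA comm_group_MA H MH internal_direct_sum_MS)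
qed

end
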